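(* Let $R$ be a commutative local ring, let $r\ge 1$, and let $A=(a_{ij})$ be a $2r\times 2r$ strictly upper triangular matrix with entries in $R$. There is a matrix $U\in \operatorname{GL}(2r,R)$ such that $$UAU^{-1}=\begin{bmatrix}0_r & 1_r\\ 0_r & 0_r\end{bmatrix}$$ if and only if the solutions in $R$ of the linear system of equations $$\sum_{j=1}^{2r}a_{ij}x_j=0\quad\text{for } i=1,\dots,2r$$ are precisely the $R$-linear combinations of the columns of $A$.
   Context: $0_r$ and $1_r$ denote the $r\times r$ zero matrix and identity matrix, respectively. Strictly upper triangular means $a_{ij}=0$ whenever $i\geq j$. *)

theory Defs
  imports "HOL-Algebra.Ideal" "Jordan_Normal_Form.VS_Connect"
begin

text \<open>A commutative local ring is a commutative ring with exactly one maximal ideal. The zero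
  ring is excluded, since \<^locale>\<open>maximalideal\<close> requires a maximal ideal to be proper.\<close>

definition local_ring :: "('a, 'b) ring_scheme \<Rightarrow> bool" where
  "local_ring R \<longleftrightarrow> cring R \<and> (\<exists>!M. maximalideal M R)"

text \<open>Matrix indices start at 0 in the library; a shift of both indices does not change this
  condition.\<close>

definition strictly_upper_triangular :: "'a::zero mat \<Rightarrow> bool" where
  "strictly_upper_triangular A \<longleftrightarrow> (\<forall>i<dim_row A. \<forall>j<dim_col A. j \<le> i \<longrightarrow> A $$ (i, j) = 0)"

definition GL :: "nat \<Rightarrow> 'a::comm_ring_1 mat set" where
  "GL n = Units (ring_mat TYPE('a) n ())"

definition GL_inv :: "nat \<Rightarrow> 'a::comm_ring_1 mat \<Rightarrow> 'a mat" where
  "GL_inv n U = inv\<^bsub>ring_mat TYPE('a) n ()\<^esub> U"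

text \<open>The solutions in \<open>R\<^sup>n\<close> of the homogeneous linear system with coefficient matrix \<open>A\<close>, where
  \<open>n\<close> is the number of columns of \<open>A\<close>.\<close>

definition solutions :: "'a::comm_ring_1 mat \<Rightarrow> 'a vec set" where
  "solutions A = {x \<in> carrier_vec (dim_col A).
     \<forall>i<dim_row A. (\<Sum>j<dim_col A. A $$ (i, j) * x $ j) = 0}"

text \<open>Collecting the columns in a set identifies equal columns, which does not change their linear
  combinations.\<close>

definition column_combinations :: "'a::comm_ring_1 mat \<Rightarrow> 'a vec set" where
  "column_combinations A =
     LinearCombinations.module.span class_ring (module_vec TYPE('a) (dim_row A)) (set (cols A))"

end

theory Submission
  imports Defs
begin

text \<open>View \<open>A\<close> as a differential on \<open>R\<^sup>n\<close> with \<open>n = 2r\<close>. The condition on the linear system says that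
  this differential is exact. The proof compares both sides of the equivalence with a third
  condition, the existence of a contraction: \<open>A\<^sup>2 = 0\<close>, and \<open>A H + H A = 1\<close> for some matrix \<open>H\<close>.

  A contraction always gives exactness, since \<open>A x = 0\<close> implies \<open>x = A (H x)\<close>. In general the
  converse fails: over \<open>k[t]/(t\<^sup>2)\<close> the scalar matrix \<open>t\<close> is exact, but it becomes zero modulo the
  maximal ideal, so it has no contraction. Strict upper triangularity is what makes the converse
  true: \<open>A e\<^sub>k\<close> lies in the span of the preceding basis vectors, so \<open>H e\<^sub>k\<close> can be found by recursion
  on \<open>k\<close> (\<open>partial_contraction\<close>).

  The normal form is contracted by its transpose, and conjugation carries contractions along.
  Conversely, a contraction can be changed into one, \<open>K\<close>, with \<open>K\<^sup>2 = 0\<close>. Then \<open>A K\<close> and \<open>K A\<close> are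
  complementary idempotents, and \<open>A\<close> and \<open>K\<close> are mutually inverse isomorphisms between their
  images. Over a local ring the image of an idempotent matrix is free
  (\<open>idempotent_splits_freely\<close>); a basis \<open>P\<close> of the image of \<open>A K\<close> and the basis \<open>K P\<close> of the image of
  \<open>K A\<close> together form the basis of \<open>R\<^sup>n\<close> in which \<open>A\<close> has the normal form
  (\<open>contraction_imp_normal_form\<close>). The two halves have the same size, so that size is \<open>r\<close> because the
  dimensions of an invertible matrix over a nonzero commutative ring agree.\<close>

section \<open>Local rings\<close>

text \<open>Closure under negation follows from multiplication by \<open>- 1\<close>.\<close>

lemma ideal_class_ringI:
  fixes I :: "'a::comm_ring_1 set"
  assumes "0 \<in> I" and "\<And>x y. x \<in> I \<Longrightarrow> y \<in> I \<Longrightarrow> x + y \<in> I" and "\<And>x y. x \<in> I \<Longrightarrow> y * x \<in> I"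
  shows "ideal I (class_ring :: 'a ring)"
proof (rule idealI)
  show "ring (class_ring :: 'a ring)" by (rule class_ring.ring_axioms)
  have inv: "inv\<^bsub>add_monoid (class_ring :: 'a ring)\<^esub> x = - x" for x :: 'a
    using class_ring_simps unfolding a_inv_def by metis
  show "subgroup I (add_monoid (class_ring :: 'a ring))"
  proof (rule subgroup.intro)
    fix x assume "x \<in> I"
    then have "- x \<in> I" using assms(3)[of x "-1"] by simp
    then show "inv\<^bsub>add_monoid (class_ring :: 'a ring)\<^esub> x \<in> I" by (simp only: inv)
  qed (use assms in auto)
qed (use assms(3) in \<open>auto simp: mult.commute\<close>)

lemma ideal_class_ringD:
  fixes I :: "'a::comm_ring_1 set"
  assumes "ideal I (class_ring :: 'a ring)"
  shows "0 \<in> I" and "x \<in> I \<Longrightarrow> y \<in> I \<Longrightarrow> x + y \<in> I" and "x \<in> I \<Longrightarrow> y * x \<in> I"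
proof -
  interpret ideal I "class_ring :: 'a ring" by fact
  show "0 \<in> I" using additive_subgroup.zero_closed[OF is_additive_subgroup] by simp
  show "x \<in> I \<Longrightarrow> y \<in> I \<Longrightarrow> x + y \<in> I"
    using additive_subgroup.a_closed[OF is_additive_subgroup, of x y] by simp
  show "x \<in> I \<Longrightarrow> y * x \<in> I" using I_l_closed[of x y] by simp
qed

text \<open>Krull's theorem for the ideal of multiples of \<open>x\<close>, which is proper when \<open>x\<close> is no unit: a union
  of a chain of ideals that avoid 1 still avoids 1, so Zorn's lemma applies.\<close>

lemma nonunit_in_maximalideal:
  fixes x :: "'a::comm_ring_1"
  assumes "\<not> x dvd 1"
  obtains M where "maximalideal M (class_ring :: 'a ring)" and "x \<in> M"
proof -
  let ?R = "class_ring :: 'a ring"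
  let ?F = "{I. ideal I ?R \<and> x \<in> I \<and> 1 \<notin> I}"
  have nonempty: "range ((*) x) \<in> ?F"
  proof -
    have "ideal (range ((*) x)) ?R"
    proof (rule ideal_class_ringI)
      show "0 \<in> range ((*) x)" by (rule range_eqI[of _ _ 0]) simp
    next
      fix a b assume "a \<in> range ((*) x)" "b \<in> range ((*) x)"
      then show "a + b \<in> range ((*) x)" by (auto simp: distrib_left[symmetric])
    next
      fix a b assume "a \<in> range ((*) x)"
      then obtain c where "a = x * c" by blast
      then show "b * a \<in> range ((*) x)" by (intro range_eqI[of _ _ "b * c"]) (simp add: ac_simps)
    qed
    moreover have "x \<in> range ((*) x)" by (rule range_eqI[of _ _ 1]) simp
    moreover have "1 \<notin> range ((*) x)" using assms by (auto simp: dvd_def)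
    ultimately show ?thesis by blast
  qed
  have "\<Union>C \<in> ?F" if "C \<noteq> {}" and chain: "subset.chain ?F C" for C
  proof -
    from chain have C: "\<And>I. I \<in> C \<Longrightarrow> I \<in> ?F"
      and total: "\<And>I J. I \<in> C \<Longrightarrow> J \<in> C \<Longrightarrow> I \<subseteq> J \<or> J \<subseteq> I"
      unfolding subset.chain_def by auto
    have "ideal (\<Union>C) ?R"
    proof (rule ideal_class_ringI)
      show "0 \<in> \<Union>C" using \<open>C \<noteq> {}\<close> C ideal_class_ringD(1) by blast
    next
      fix a b assume "a \<in> \<Union>C" "b \<in> \<Union>C"
      then obtain I where "I \<in> C" "a \<in> I" "b \<in> I" using total by blast
      then show "a + b \<in> \<Union>C" using C[of I] ideal_class_ringD(2)[of I a b] by blast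
    next
      fix a b assume "a \<in> \<Union>C"
      then obtain I where "I \<in> C" "a \<in> I" by blast
      then show "b * a \<in> \<Union>C" using C[of I] ideal_class_ringD(3)[of I a b] by blast
    qed
    then show ?thesis using \<open>C \<noteq> {}\<close> C by blast
  qed
  then have "\<exists>M\<in>?F. \<forall>J\<in>?F. M \<subseteq> J \<longrightarrow> J = M"
    using nonempty by (intro subset_Zorn_nonempty) auto
  then obtain M where M: "M \<in> ?F" and max: "\<forall>J\<in>?F. M \<subseteq> J \<longrightarrow> J = M" by (rule bexE)
  have "maximalideal M ?R"
  proof (rule maximalidealI)
    show "ideal M ?R" using M by blast
    show "carrier ?R \<noteq> M" using M by auto
    fix J assume J: "ideal J ?R" "M \<subseteq> J"
    show "J = M \<or> J = carrier ?R"
    proof (cases "1 \<in> J")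
      case True
      then have "y \<in> J" for y using ideal_class_ringD(3)[OF J(1) True, of y] by simp
      then show ?thesis by auto
    next
      case False
      then show ?thesis using max J M by auto
    qed
  qed
  then show ?thesis using that M by blast
qed

text \<open>Otherwise \<open>x\<close> and \<open>1 - x\<close> both lie in the unique maximal ideal, and so does their sum 1. This is
  the form in which locality drives the elimination below.\<close>

lemma local_ring_unit_or_unit:
  fixes x :: "'a::comm_ring_1"
  assumes "local_ring (class_ring :: 'a ring)"
  shows "x dvd 1 \<or> 1 - x dvd 1"
proof (rule ccontr)
  assume "\<not> ?thesis"
  then have nx: "\<not> x dvd 1" and ny: "\<not> 1 - x dvd 1" by auto
  obtain M where M: "maximalideal M (class_ring :: 'a ring)" "x \<in> M"
    by (rule nonunit_in_maximalideal[OF nx])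
  obtain M' where M': "maximalideal M' (class_ring :: 'a ring)" "1 - x \<in> M'"
    by (rule nonunit_in_maximalideal[OF ny])
  have "M' = M" using assms M M' unfolding local_ring_def by blast
  interpret M: maximalideal M "class_ring :: 'a ring" by fact
  have "x + (1 - x) \<in> M"
    using ideal_class_ringD(2)[OF M.is_ideal M(2), of "1 - x"] M'(2) \<open>M' = M\<close> by blast
  then have "1 \<in> M" by simp
  then have "y \<in> M" for y using ideal_class_ringD(3)[OF M.is_ideal, of 1 y] by simp
  then show False using M.I_notcarr by auto
qed

lemma local_ring_one_neq_zero:
  assumes "local_ring (class_ring :: 'a::comm_ring_1 ring)"
  shows "(1::'a) \<noteq> 0"
proof
  assume "(1::'a) = 0"
  then have zero: "y = 0" for y :: 'a by (metis mult_1 mult_zero_left)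
  obtain M where M: "maximalideal M (class_ring :: 'a ring)"
    using assms unfolding local_ring_def by blast
  interpret M: maximalideal M "class_ring :: 'a ring" by fact
  have "0 \<in> M" using ideal_class_ringD(1)[OF M.is_ideal] .
  then have "y \<in> M" for y using zero[of y] by metis
  then show False using M.I_notcarr by auto
qed

section \<open>Matrix algebra\<close>

text \<open>Stated with dimensions instead of carriers, so that the simplifier can discharge the side
  conditions for compound factors.\<close>

lemma mat_assoc:
  fixes A :: "'a::comm_ring_1 mat"
  assumes "dim_col A = dim_row B" and "dim_col B = dim_row C"
  shows "A * B * C = A * (B * C)"
  by (rule assoc_mult_mat[of A "dim_row A" "dim_row B" B "dim_row C" C "dim_col C"])
    (use assms in auto)

definition hcat :: "'a::zero mat \<Rightarrow> 'a mat \<Rightarrow> 'a mat" where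
  "hcat A B = four_block_mat A B (0\<^sub>m 0 (dim_col A)) (0\<^sub>m 0 (dim_col B))"

lemma hcat_carrier [simp]:
  "A \<in> carrier_mat n s \<Longrightarrow> B \<in> carrier_mat n t \<Longrightarrow> hcat A B \<in> carrier_mat n (s + t)"
  using four_block_carrier_mat[of A n s "0\<^sub>m 0 t" 0 t] by (simp add: hcat_def)

lemma mult_hcat:
  fixes M :: "'a::comm_ring_1 mat"
  assumes "M \<in> carrier_mat m n" "A \<in> carrier_mat n s" "B \<in> carrier_mat n t"
  shows "M * hcat A B = hcat (M * A) (M * B)"
proof (rule eq_matI)
  fix i j assume "i < dim_row (hcat (M * A) (M * B))" "j < dim_col (hcat (M * A) (M * B))"
  then show "(M * hcat A B) $$ (i, j) = hcat (M * A) (M * B) $$ (i, j)"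
    using assms by (auto simp: hcat_def scalar_prod_def)
qed (use assms in \<open>auto simp: hcat_def\<close>)

lemma append_rows_mult_hcat:
  fixes A :: "'a::comm_ring_1 mat"
  assumes "A \<in> carrier_mat a n" "B \<in> carrier_mat b n" "C \<in> carrier_mat n s" "D \<in> carrier_mat n t"
  shows "(A @\<^sub>r B) * hcat C D = four_block_mat (A * C) (A * D) (B * C) (B * D)"
proof -
  have "four_block_mat A (0\<^sub>m a 0) B (0\<^sub>m b 0) * four_block_mat C D (0\<^sub>m 0 s) (0\<^sub>m 0 t)
     = four_block_mat (A * C + 0\<^sub>m a 0 * 0\<^sub>m 0 s) (A * D + 0\<^sub>m a 0 * 0\<^sub>m 0 t)
         (B * C + 0\<^sub>m b 0 * 0\<^sub>m 0 s) (B * D + 0\<^sub>m b 0 * 0\<^sub>m 0 t)"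
    by (rule mult_four_block_mat) (use assms in auto)
  then show ?thesis using assms by (simp add: append_rows_def hcat_def)
qed

lemma hcat_mult_append_rows:
  fixes A :: "'a::comm_ring_1 mat"
  assumes "A \<in> carrier_mat n a" "B \<in> carrier_mat n b" "C \<in> carrier_mat a m" "D \<in> carrier_mat b m"
  shows "hcat A B * (C @\<^sub>r D) = A * C + B * D"
proof -
  have "four_block_mat A B (0\<^sub>m 0 a) (0\<^sub>m 0 b) * four_block_mat C (0\<^sub>m a 0) D (0\<^sub>m b 0)
     = four_block_mat (A * C + B * D) (A * 0\<^sub>m a 0 + B * 0\<^sub>m b 0)
         (0\<^sub>m 0 a * C + 0\<^sub>m 0 b * D) (0\<^sub>m 0 a * 0\<^sub>m a 0 + 0\<^sub>m 0 b * 0\<^sub>m b 0)"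
    by (rule mult_four_block_mat) (use assms in auto)
  also have "\<dots> = A * C + B * D" by (rule eq_matI) (use assms in auto)
  finally show ?thesis using assms by (simp add: append_rows_def hcat_def)
qed

text \<open>If \<open>n > m\<close>, padding \<open>P\<close> with zero columns and \<open>Q\<close> with zero rows gives square matrices with
  product 1, although the second one has a zero row and hence determinant 0.\<close>

lemma mat_right_inverse_dim_le:
  fixes P :: "'a::comm_ring_1 mat"
  assumes "(1::'a) \<noteq> 0" and P: "P \<in> carrier_mat n m" and Q: "Q \<in> carrier_mat m n"
    and PQ: "P * Q = 1\<^sub>m n"
  shows "n \<le> m"
proof (rule ccontr)
  assume "\<not> n \<le> m"
  then obtain d where n: "n = m + d" and "d > 0" by (metis less_imp_add_positive not_le)
  define P' where "P' = hcat P (0\<^sub>m n d)"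
  define Q' where "Q' = Q @\<^sub>r 0\<^sub>m d n"
  have P': "P' \<in> carrier_mat n n" using P unfolding P'_def n by simp
  have Q': "Q' \<in> carrier_mat n n" using carrier_append_rows[OF Q, of "0\<^sub>m d n" d] unfolding Q'_def n by simp
  have "P' * Q' = 1\<^sub>m n"
    unfolding P'_def Q'_def using P Q PQ by (subst hcat_mult_append_rows[of _ n m _ d _ n]) auto
  then have "det P' * det Q' = 1" using det_mult[OF P' Q'] by simp
  \<comment> \<open>Row \<open>m\<close> is the first padding row; scaling it by 0 changes nothing.\<close>
  moreover have "multrow m 0 Q' = Q'"
    by (rule eq_matI) (use Q Q' n \<open>d > 0\<close> in \<open>auto simp: Q'_def append_rows_def\<close>)
  then have "det Q' = 0" using det_multrow[OF _ Q', of m 0] n \<open>d > 0\<close> by simp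
  ultimately show False using assms(1) by simp
qed

lemma mat_inverses_dim_eq:
  fixes P :: "'a::comm_ring_1 mat"
  assumes "(1::'a) \<noteq> 0" "P \<in> carrier_mat n m" "Q \<in> carrier_mat m n"
    and "P * Q = 1\<^sub>m n" "Q * P = 1\<^sub>m m"
  shows "n = m"
  using mat_right_inverse_dim_le[OF assms(1,2,3,4)] mat_right_inverse_dim_le[OF assms(1,3,2,5)]
  by simp

section \<open>Idempotents over local rings\<close>

text \<open>For a factorisation of this kind, \<open>e\<close> is idempotent and the columns of \<open>P\<close> are a basis of its image.\<close>

definition splits_freely :: "nat \<Rightarrow> 'a::comm_ring_1 mat \<Rightarrow> bool" where
  "splits_freely n e \<longleftrightarrow>
     (\<exists>s. \<exists>P\<in>carrier_mat n s. \<exists>Q\<in>carrier_mat s n. P * Q = e \<and> Q * P = 1\<^sub>m s)"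

lemma splits_freely_zero: "splits_freely n (0\<^sub>m n n :: 'a::comm_ring_1 mat)"
proof -
  have "0\<^sub>m n 0 * 0\<^sub>m 0 n = (0\<^sub>m n n :: 'a mat)" by simp
  moreover have "0\<^sub>m 0 n * 0\<^sub>m n 0 = (1\<^sub>m 0 :: 'a mat)" by (rule eq_matI) auto
  ultimately show ?thesis
    unfolding splits_freely_def
    by (intro exI[of _ 0] bexI[of _ "0\<^sub>m n 0"] bexI[of _ "0\<^sub>m 0 n"]) auto
qed

text \<open>Here \<open>v w\<close> is an idempotent of rank one below \<open>e\<close>, so \<open>e - v w\<close> is an idempotent orthogonal to
  it. A basis of the image of \<open>e - v w\<close> becomes one of the image of \<open>e\<close> when \<open>v\<close> is added.\<close>

lemma peel_rank_one:
  fixes e :: "'a::comm_ring_1 mat"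
  assumes e: "e \<in> carrier_mat n n" and ee: "e * e = e"
    and v: "v \<in> carrier_mat n 1" and w: "w \<in> carrier_mat 1 n"
    and ev: "e * v = v" and we: "w * e = w" and wv: "w * v = 1\<^sub>m 1"
  shows "(e - v * w) * (e - v * w) = e - v * w"
    and "splits_freely n (e - v * w) \<Longrightarrow> splits_freely n e"
proof -
  define f where "f = e - v * w"
  have vw: "v * w \<in> carrier_mat n n" using v w by simp
  have f: "f \<in> carrier_mat n n" unfolding f_def using vw by (rule minus_carrier_mat)
  have "f * v = e * v - v * w * v"
    unfolding f_def by (rule minus_mult_distrib_mat[OF e vw v])
  also have "v * w * v = v" using v w wv by (simp add: mat_assoc)
  finally have fv: "f * v = 0\<^sub>m n 1" using ev v by auto
  have "w * f = w * e - w * (v * w)"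
    unfolding f_def by (rule mult_minus_distrib_mat[OF w e vw])
  also have "w * (v * w) = w * v * w" using v w by (simp add: mat_assoc)
  finally have wf: "w * f = 0\<^sub>m 1 n" using we wv w by auto
  have "f * f = f * e - f * (v * w)"
    using mult_minus_distrib_mat[OF f e vw] by (simp add: f_def)
  also have "f * (v * w) = f * v * w" using f v w by (simp add: mat_assoc)
  also have "\<dots> = 0\<^sub>m n n" using fv w by simp
  also have "f * e = e * e - v * w * e"
    unfolding f_def by (rule minus_mult_distrib_mat[OF e vw e])
  also have "v * w * e = v * w" using v w e we by (simp add: mat_assoc)
  finally have "f * f = f - 0\<^sub>m n n" using ee by (simp add: f_def)
  also have "\<dots> = f" by (rule eq_matI) (use f in auto)
  finally have "f * f = f" .
  then show "(e - v * w) * (e - v * w) = e - v * w" by (simp add: f_def)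
  assume "splits_freely n (e - v * w)"
  then obtain s P Q where P: "P \<in> carrier_mat n s" and Q: "Q \<in> carrier_mat s n"
    and PQ: "P * Q = f" and QP: "Q * P = 1\<^sub>m s"
    unfolding splits_freely_def f_def by blast
  have "Q * v = Q * P * (Q * v)" using QP Q v by simp
  also have "\<dots> = Q * (P * Q * v)" using P Q v by (simp add: mat_assoc)
  finally have Qv: "Q * v = 0\<^sub>m s 1" using fv Q unfolding PQ by simp
  have "w * P = w * P * (Q * P)" using QP P w by simp
  also have "\<dots> = w * (P * Q) * P" using P Q w by (simp add: mat_assoc)
  finally have wP: "w * P = 0\<^sub>m 1 s" using wf P unfolding PQ by simp
  have "hcat v P * (w @\<^sub>r Q) = v * w + f"
    using hcat_mult_append_rows[OF v P w Q] PQ by simp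
  also have "\<dots> = e" unfolding f_def by (rule eq_matI) (use e v w in auto)
  finally have 1: "hcat v P * (w @\<^sub>r Q) = e" .
  have 2: "(w @\<^sub>r Q) * hcat v P = 1\<^sub>m (1 + s)"
    using append_rows_mult_hcat[OF w Q v P] by (simp only: wv wP Qv QP four_block_one_mat)
  show "splits_freely n e"
    unfolding splits_freely_def
    by (rule exI[of _ "1 + s"], rule bexI[of _ "hcat v P"], rule bexI[of _ "w @\<^sub>r Q"])
      (use 1 2 hcat_carrier[OF v P] carrier_append_rows[OF w Q] in auto)
qed

text \<open>When \<open>X Y\<close> and \<open>Y X\<close> are both idempotent, \<open>X\<close> and \<open>Y\<close> restrict to mutually inverse isomorphisms
  between their images; a splitting \<open>P Q\<close> of \<open>X Y\<close> is carried back to \<open>(Y P) (Q X)\<close>.\<close>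

lemma splits_freely_swap:
  fixes X :: "'a::comm_ring_1 mat"
  assumes X: "X \<in> carrier_mat n n" and Y: "Y \<in> carrier_mat n n"
    and idem: "Y * X * (Y * X) = Y * X" and "splits_freely n (X * Y)"
  shows "splits_freely n (Y * X)"
proof -
  obtain s P Q where P: "P \<in> carrier_mat n s" and Q: "Q \<in> carrier_mat s n"
    and PQ: "P * Q = X * Y" and QP: "Q * P = 1\<^sub>m s"
    using assms(4) unfolding splits_freely_def by blast
  have "Y * P * (Q * X) = Y * (P * Q) * X" using X Y P Q by (simp add: mat_assoc)
  also have "\<dots> = Y * X * (Y * X)" unfolding PQ using X Y by (simp add: mat_assoc)
  finally have 1: "Y * P * (Q * X) = Y * X" using idem by simp
  have "Q * X * (Y * P) = Q * (X * Y) * P" using X Y P Q by (simp add: mat_assoc)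
  also have "\<dots> = Q * P * (Q * P)" unfolding PQ[symmetric] using P Q by (simp add: mat_assoc)
  finally have 2: "Q * X * (Y * P) = 1\<^sub>m s" using QP by simp
  show ?thesis
    unfolding splits_freely_def
    by (rule exI[of _ s], rule bexI[of _ "Y * P"], rule bexI[of _ "Q * X"])
      (use 1 2 X Y P Q in auto)
qed

text \<open>Elimination on the diagonal: the first \<open>k\<close> rows and columns are already zero, and each step clears
  row and column \<open>k\<close>. If \<open>u = e\<^sub>k\<^sub>k\<close> is a unit, then column \<open>k\<close> of \<open>e\<close>, together with row \<open>k\<close> divided by
  \<open>u\<close>, is a rank one idempotent that can be peeled off. If instead \<open>1 - u\<close> is a unit, then deleting
  coordinate \<open>k\<close> is injective on the image of \<open>e\<close>, so the image is isomorphic to that of an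
  idempotent with zero row and column \<open>k\<close>.\<close>

lemma idempotent_splits_aux:
  fixes e :: "'a::comm_ring_1 mat"
  assumes unit: "\<And>x::'a. x dvd 1 \<or> 1 - x dvd 1"
    and "k \<le> n" and "e \<in> carrier_mat n n" and "e * e = e"
    and "\<And>i j. i < n \<Longrightarrow> j < n \<Longrightarrow> i < k \<or> j < k \<Longrightarrow> e $$ (i, j) = 0"
  shows "splits_freely n e"
  using assms(2-)
proof (induction k arbitrary: e rule: inc_induct)
  case base
  then have "e = 0\<^sub>m n n" by (intro eq_matI) auto
  then show ?case by (simp add: splits_freely_zero)
next
  case (step k)
  note e = step.prems(1) and ee = step.prems(2) and zero = step.prems(3)
  have k: "k < n" using step.hyps by simp
  have sum: "(\<Sum>l=0..<n. e $$ (i, l) * e $$ (l, j)) = e $$ (i, j)" if "i < n" "j < n" for i j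
  proof -
    have "(e * e) $$ (i, j) = (\<Sum>l=0..<n. e $$ (i, l) * e $$ (l, j))"
      using that e by (auto simp: scalar_prod_def)
    then show ?thesis using ee by simp
  qed
  from unit[of "e $$ (k, k)"] show ?case
  proof
    assume "e $$ (k, k) dvd 1"
    then obtain c where c: "e $$ (k, k) * c = 1" by (metis dvd_def)
    define v where "v = mat n 1 (\<lambda>(i, j). e $$ (i, k))"
    define w where "w = mat 1 n (\<lambda>(i, j). c * e $$ (k, j))"
    have v: "v \<in> carrier_mat n 1" and w: "w \<in> carrier_mat 1 n" unfolding v_def w_def by auto
    have ev: "e * v = v"
      by (rule eq_matI) (use e sum k in \<open>auto simp: v_def scalar_prod_def\<close>)
    have csum: "(\<Sum>l=0..<n. c * e $$ (k, l) * e $$ (l, j)) = c * e $$ (k, j)" if "j < n" for j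
      using sum[OF k that] by (simp add: mult.assoc flip: sum_distrib_left)
    have we: "w * e = w"
      by (rule eq_matI) (use e csum in \<open>auto simp: w_def scalar_prod_def\<close>)
    have wv: "w * v = 1\<^sub>m 1"
      by (rule eq_matI) (use csum[OF k] c in \<open>auto simp: v_def w_def scalar_prod_def mult.commute[of c]\<close>)
    note peel = peel_rank_one[OF e ee v w ev we wv]
    have "(e - v * w) $$ (i, j) = 0" if "i < n" "j < n" "i < Suc k \<or> j < Suc k" for i j
    proof -
      have *: "(e - v * w) $$ (i, j) = e $$ (i, j) - e $$ (i, k) * (c * e $$ (k, j))"
        using that e by (simp add: v_def w_def scalar_prod_def)
      from that consider "i < k \<or> j < k" | "i = k" | "j = k" by linarith
      then show ?thesis
      proof cases
        case 1
        then show ?thesis using * that k zero[of i j] zero[of i k] zero[of k j] by auto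
      next
        case 2
        then show ?thesis using * c by (simp flip: mult.assoc)
      next
        case 3
        then show ?thesis using * c by (simp add: mult.commute[of c])
      qed
    qed
    then have "splits_freely n (e - v * w)"
      using step.IH[OF _ peel(1)] v w by (simp add: minus_carrier_mat)
    then show ?case by (rule peel(2))
  next
    assume "1 - e $$ (k, k) dvd 1"
    then obtain c where c: "(1 - e $$ (k, k)) * c = 1" by (metis dvd_def)
    \<comment> \<open>\<open>X\<close> is \<open>e\<close> followed by deletion of coordinate \<open>k\<close>, that is \<open>D e\<close> with a diagonal projection \<open>D\<close>.
      On the image of \<open>e\<close> the matrix \<open>e D e\<close> is the identity minus the rank one matrix (column \<open>k\<close>)
      times (row \<open>k\<close>) of \<open>e\<close>; the Sherman-Morrison formula for its inverse, with \<open>c\<close> the inverse of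
      \<open>1 - u\<close>, gives the entries of \<open>Y\<close>.\<close>
    define X where "X = mat n n (\<lambda>(i, j). if i = k then 0 else e $$ (i, j))"
    define Y where "Y = mat n n (\<lambda>(i, j). if j = k then 0 else e $$ (i, j) + c * e $$ (i, k) * e $$ (k, j))"
    have X: "X \<in> carrier_mat n n" and Y: "Y \<in> carrier_mat n n" unfolding X_def Y_def by auto
    have YX: "Y * X = e"
    proof (rule eq_matI)
      fix i j assume "i < dim_row e" "j < dim_col e"
      then have i: "i < n" and j: "j < n" using e by auto
      let ?t = "\<lambda>l. (e $$ (i, l) + c * e $$ (i, k) * e $$ (k, l)) * e $$ (l, j)"
      have "(Y * X) $$ (i, j) = (\<Sum>l=0..<n. if l = k then 0 else ?t l)"
        using i j by (auto simp: X_def Y_def scalar_prod_def intro!: sum.cong)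
      also have "\<dots> = (\<Sum>l=0..<n. ?t l) - (\<Sum>l=0..<n. if l = k then ?t l else 0)"
        by (subst sum_subtractf[symmetric]) (rule sum.cong, auto)
      also have "(\<Sum>l=0..<n. if l = k then ?t l else 0) = ?t k" using k by simp
      also have "(\<Sum>l=0..<n. ?t l) = e $$ (i, j) + c * e $$ (i, k) * e $$ (k, j)"
        using sum[OF i j] sum[OF k j]
        by (simp add: distrib_right sum.distrib mult.assoc flip: sum_distrib_left)
      also have "\<dots> - ?t k = e $$ (i, j) + ((1 - e $$ (k, k)) * c - 1) * (e $$ (i, k) * e $$ (k, j))"
        by (simp add: algebra_simps)
      finally show "(Y * X) $$ (i, j) = e $$ (i, j)" using c by simp
    qed (use e X Y in auto)
    have Xe: "X * e = X"
      by (rule eq_matI) (use e sum in \<open>auto simp: X_def scalar_prod_def\<close>)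
    have XY: "X * Y \<in> carrier_mat n n" using X Y by auto
    have "X * Y * (X * Y) = X * (Y * X) * Y" using X Y by (simp add: mat_assoc)
    then have idem: "X * Y * (X * Y) = X * Y" using YX Xe by simp
    have "(X * Y) $$ (i, j) = 0" if "i < n" "j < n" "i < Suc k \<or> j < Suc k" for i j
    proof -
      have "X $$ (i, l) * Y $$ (l, j) = 0" if "l < n" for l
        using \<open>i < n\<close> \<open>j < n\<close> \<open>i < Suc k \<or> j < Suc k\<close> that k zero[of i l] zero[of l j] zero[of k j]
        unfolding X_def Y_def by (auto simp: less_Suc_eq)
      then show ?thesis using that X Y by (simp add: scalar_prod_def)
    qed
    then have "splits_freely n (X * Y)" using step.IH[OF XY idem] by blast
    then show ?case using splits_freely_swap[OF X Y] YX ee by simp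
  qed
qed

lemma idempotent_splits_freely:
  fixes e :: "'a::comm_ring_1 mat"
  assumes "local_ring (class_ring :: 'a ring)" and "e \<in> carrier_mat n n" and "e * e = e"
  shows "splits_freely n e"
  using idempotent_splits_aux[OF local_ring_unit_or_unit[OF assms(1)], of 0 n e] assms(2,3) by simp

section \<open>Contractions and exactness\<close>

lemma mult_mat_vec_smult:
  fixes A :: "'a::comm_ring_1 mat"
  assumes "dim_col A = dim_vec y"
  shows "A *\<^sub>v (c \<cdot>\<^sub>v y) = c \<cdot>\<^sub>v (A *\<^sub>v y)"
  by (rule eq_vecI) (use assms in auto)

lemma solutions_eq_kernel:
  "solutions A = {x \<in> carrier_vec (dim_col A). A *\<^sub>v x = 0\<^sub>v (dim_row A)}"
proof -
  have "(\<forall>i<dim_row A. (\<Sum>j<dim_col A. A $$ (i, j) * x $ j) = 0) \<longleftrightarrow> A *\<^sub>v x = 0\<^sub>v (dim_row A)"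
    if "x \<in> carrier_vec (dim_col A)" for x
    using that by (auto simp: vec_eq_iff scalar_prod_def atLeast0LessThan)
  then show ?thesis unfolding solutions_def by blast
qed

lemma column_combinations_eq_range:
  fixes A :: "'a::comm_ring_1 mat"
  assumes A: "A \<in> carrier_mat m n"
  shows "column_combinations A = (\<lambda>y. A *\<^sub>v y) ` carrier_vec n"
proof -
  interpret V: vec_module "TYPE('a)" m .
  let ?Im = "(\<lambda>y. A *\<^sub>v y) ` carrier_vec n"
  have cols: "set (cols A) \<subseteq> carrier_vec m" using A cols_dim by blast
  have comb: "column_combinations A = V.span (set (cols A))"
    unfolding column_combinations_def using A by simp
  have "submodule class_ring ?Im (module_vec TYPE('a) m)"
  proof (rule submodule.intro)
    show "module class_ring (module_vec TYPE('a) m)" by (rule V.module_axioms)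
    show "?Im \<subseteq> carrier (module_vec TYPE('a) m)" using A by (auto simp: module_vec_simps)
  next
    fix a b assume "a \<in> ?Im" "b \<in> ?Im"
    then obtain y z where "y \<in> carrier_vec n" "z \<in> carrier_vec n" "a = A *\<^sub>v y" "b = A *\<^sub>v z" by blast
    then show "a \<oplus>\<^bsub>module_vec TYPE('a) m\<^esub> b \<in> ?Im"
      using A by (auto simp: module_vec_simps mult_add_distrib_mat_vec[OF A, symmetric])
  next
    show "\<zero>\<^bsub>module_vec TYPE('a) m\<^esub> \<in> ?Im"
      using A by (intro image_eqI[of _ _ "0\<^sub>v n"]) (auto simp: module_vec_simps)
  next
    fix c :: 'a and a assume "a \<in> ?Im"
    then obtain y where y: "y \<in> carrier_vec n" "a = A *\<^sub>v y" by blast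
    then show "c \<odot>\<^bsub>module_vec TYPE('a) m\<^esub> a \<in> ?Im"
      using A by (intro image_eqI[of _ _ "c \<cdot>\<^sub>v y"]) (auto simp: module_vec_simps mult_mat_vec_smult)
  qed
  moreover have "set (cols A) \<subseteq> ?Im"
  proof
    fix a assume "a \<in> set (cols A)"
    then obtain j where "j < n" "a = col A j" using A by (auto simp: cols_def)
    then show "a \<in> ?Im"
      using A by (intro image_eqI[of _ _ "unit_vec n j"]) (auto intro!: eq_vecI)
  qed
  ultimately have "V.span (set (cols A)) \<subseteq> ?Im" by (rule V.span_is_subset[rotated])
  moreover have "?Im \<subseteq> V.span (set (cols A))"
  proof
    fix a assume "a \<in> ?Im"
    then obtain y where y: "y \<in> carrier_vec n" "a = A *\<^sub>v y" by blast
    have "mat_of_cols m (cols A) *\<^sub>v y =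
        V.lincomb (\<lambda>l. \<Sum>i = 0..<length (cols A). if l = cols A ! i then y $ i else 0) (set (cols A))"
      by (rule V.mat_of_cols_mult_as_finsum) (use y A in auto)
    moreover have "mat_of_cols m (cols A) = A" using A mat_of_cols_cols by auto
    ultimately show "a \<in> V.span (set (cols A))"
      unfolding V.span_def using y(2) by auto
  qed
  ultimately show ?thesis using comb by simp
qed

text \<open>A null-homotopic identity forces zero homology.\<close>

lemma contraction_imp_exact:
  fixes A :: "'a::comm_ring_1 mat"
  assumes A: "A \<in> carrier_mat n n" and H: "H \<in> carrier_mat n n"
    and AA: "A * A = 0\<^sub>m n n" and AH: "A * H + H * A = 1\<^sub>m n"
  shows "solutions A = column_combinations A"
proof
  show "solutions A \<subseteq> column_combinations A"
  proof
    fix x assume "x \<in> solutions A"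
    then have x: "x \<in> carrier_vec n" and Ax: "A *\<^sub>v x = 0\<^sub>v n"
      using A by (auto simp: solutions_eq_kernel)
    have "x = (A * H + H * A) *\<^sub>v x" using AH x by simp
    also have "\<dots> = A *\<^sub>v (H *\<^sub>v x) + H *\<^sub>v (A *\<^sub>v x)"
      using A H x by (simp add: add_mult_distrib_mat_vec[of _ n n])
    also have "\<dots> = A *\<^sub>v (H *\<^sub>v x)" using A H x Ax by auto
    finally show "x \<in> column_combinations A"
      using H x by (auto simp: column_combinations_eq_range[OF A])
  qed
  show "column_combinations A \<subseteq> solutions A"
  proof
    fix x assume "x \<in> column_combinations A"
    then obtain y where y: "y \<in> carrier_vec n" "x = A *\<^sub>v y"
      by (auto simp: column_combinations_eq_range[OF A])
    then have "A *\<^sub>v x = (A * A) *\<^sub>v y" using A by simp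
    also have "\<dots> = 0\<^sub>v n" unfolding AA using y by auto
    finally show "x \<in> solutions A" using A y by (auto simp: solutions_eq_kernel)
  qed
qed

lemma exact_imp_square_zero:
  fixes A :: "'a::comm_ring_1 mat"
  assumes A: "A \<in> carrier_mat n n" and "column_combinations A \<subseteq> solutions A"
  shows "A * A = 0\<^sub>m n n"
proof (rule mat_col_eqI)
  fix j assume "j < dim_col (0\<^sub>m n n :: 'a mat)"
  then have j: "j < n" by simp
  have "A *\<^sub>v (A *\<^sub>v unit_vec n j) = 0\<^sub>v n"
  proof -
    have "A *\<^sub>v unit_vec n j \<in> solutions A"
      using assms(2) by (auto simp: column_combinations_eq_range[OF A])
    then show ?thesis using A by (simp add: solutions_eq_kernel)
  qed
  moreover have "A *\<^sub>v unit_vec n j = col A j" using A j by (auto intro!: eq_vecI)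
  ultimately show "col (A * A) j = col (0\<^sub>m n n) j"
    using j by (simp only: col_mult2[OF A A j] col_zero)
qed (use A in auto)

text \<open>The recursion behind the contraction: \<open>H\<close> is correct on the first \<open>k\<close> basis vectors. The next column
  \<open>x\<close> has to solve \<open>A x = e\<^sub>k - H a\<close> with \<open>a = A e\<^sub>k\<close>. As \<open>a\<close> is supported on the first \<open>k\<close> coordinates,
  \<open>A (H a) = a - H (A a) = a\<close>, so the right-hand side is in the kernel of \<open>A\<close>, and exactness supplies \<open>x\<close>.
  Only the columns of \<open>A\<close> after the \<open>k\<close>-th involve column \<open>k\<close> of \<open>H\<close> in \<open>H A\<close>, so replacing that
  column preserves what was achieved before.\<close>

lemma partial_contraction:
  fixes A :: "'a::comm_ring_1 mat"
  assumes A: "A \<in> carrier_mat n n" and upper: "strictly_upper_triangular A"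
    and exact: "solutions A = column_combinations A" and "k \<le> n"
  shows "\<exists>H\<in>carrier_mat n n. \<forall>j<k. A *\<^sub>v col H j + H *\<^sub>v col A j = unit_vec n j"
  using \<open>k \<le> n\<close>
proof (induction k)
  case 0
  then show ?case by (intro bexI[of _ "0\<^sub>m n n"]) auto
next
  case (Suc k)
  then obtain H where H: "H \<in> carrier_mat n n"
    and hyp: "\<And>j. j < k \<Longrightarrow> A *\<^sub>v col H j + H *\<^sub>v col A j = unit_vec n j" by auto
  have k: "k < n" using Suc.prems by simp
  have AA: "A * A = 0\<^sub>m n n" using exact_imp_square_zero[OF A] exact by simp
  have upper': "A $$ (i, j) = 0" if "i < n" "j \<le> i" for i j
    using upper that A unfolding strictly_upper_triangular_def by auto
  define a where "a = col A k"
  have a: "a \<in> carrier_vec n" using A k unfolding a_def by simp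
  let ?G = "A * H + H * A"
  have Ga: "?G *\<^sub>v a = a"
  proof (rule eq_vecI)
    fix i assume "i < dim_vec a"
    then have i: "i < n" using a by simp
    have "(?G *\<^sub>v a) $ i = (\<Sum>l=0..<n. ?G $$ (i, l) * a $ l)"
      using A H a i by (simp add: scalar_prod_def)
    also have "\<dots> = (\<Sum>l=0..<n. (if l = i then a $ l else 0))"
    proof (rule sum.cong[OF refl])
      fix l assume "l \<in> {0..<n}"
      then have l: "l < n" by simp
      show "?G $$ (i, l) * a $ l = (if l = i then a $ l else 0)"
      proof (cases "l < k")
        case True
        have "?G $$ (i, l) = (A *\<^sub>v col H l + H *\<^sub>v col A l) $ i"
          using A H i l by simp
        also have "\<dots> = unit_vec n l $ i" using hyp[OF True] by simp
        finally show ?thesis using i l by simp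
      next
        case False
        then have "a $ l = 0" using upper'[of l k] l k A unfolding a_def by simp
        then show ?thesis by auto
      qed
    qed
    also have "\<dots> = a $ i" using i by simp
    finally show "(?G *\<^sub>v a) $ i = a $ i" .
  qed (use A H a in auto)
  have Aa: "A *\<^sub>v a = 0\<^sub>v n"
  proof -
    have "A *\<^sub>v a = col (A * A) k" unfolding a_def by (rule col_mult2[OF A A k, symmetric])
    then show ?thesis using AA k by simp
  qed
  have "A *\<^sub>v (H *\<^sub>v a) + H *\<^sub>v (A *\<^sub>v a) = a"
    using Ga A H a by (simp add: add_mult_distrib_mat_vec[of _ n n])
  moreover have "H *\<^sub>v 0\<^sub>v n = 0\<^sub>v n" using H by auto
  ultimately have AHa: "A *\<^sub>v (H *\<^sub>v a) = a" using Aa A H a by simp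
  have "A *\<^sub>v unit_vec n k = a" using A k unfolding a_def by (auto intro!: eq_vecI)
  then have "A *\<^sub>v (unit_vec n k - H *\<^sub>v a) = 0\<^sub>v n"
    using AHa A H a by (simp add: mult_minus_distrib_mat_vec[of _ n n])
  then have "unit_vec n k - H *\<^sub>v a \<in> solutions A"
    using A H a by (simp add: solutions_eq_kernel)
  then have "unit_vec n k - H *\<^sub>v a \<in> column_combinations A" unfolding exact .
  then obtain x where x: "x \<in> carrier_vec n" and Ax: "unit_vec n k - H *\<^sub>v a = A *\<^sub>v x"
    by (auto simp: column_combinations_eq_range[OF A])
  define K where "K = mat n n (\<lambda>(i, j). if j = k then x $ i else H $$ (i, j))"
  have K: "K \<in> carrier_mat n n" unfolding K_def by simp
  have KA: "K *\<^sub>v col A j = H *\<^sub>v col A j" if "j \<le> k" for j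
  proof (rule eq_vecI)
    fix i assume "i < dim_vec (H *\<^sub>v col A j)"
    then have i: "i < n" using H by simp
    have "K $$ (i, l) * A $$ (l, j) = H $$ (i, l) * A $$ (l, j)" if "l < n" for l
      using i that \<open>j \<le> k\<close> upper'[of l j] by (cases "l = k") (auto simp: K_def)
    then show "(K *\<^sub>v col A j) $ i = (H *\<^sub>v col A j) $ i"
      using i K H A k \<open>j \<le> k\<close> by (auto simp: scalar_prod_def)
  qed (use K H in simp)
  have "A *\<^sub>v col K j + K *\<^sub>v col A j = unit_vec n j" if "j < Suc k" for j
  proof (cases "j = k")
    case True
    have "col K k = x" using x k by (auto simp: K_def intro!: eq_vecI)
    then have "A *\<^sub>v col K k + K *\<^sub>v col A k = (unit_vec n k - H *\<^sub>v a) + H *\<^sub>v a"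
      using KA[of k] Ax by (simp add: a_def)
    then show ?thesis using True H a by (auto intro!: eq_vecI)
  next
    case False
    then have "col K j = col H j" using that H k by (auto simp: K_def intro!: eq_vecI)
    then show ?thesis using KA[of j] hyp[of j] that False by simp
  qed
  then show ?case using K by blast
qed

lemma exact_imp_contraction:
  fixes A :: "'a::comm_ring_1 mat"
  assumes A: "A \<in> carrier_mat n n" and "strictly_upper_triangular A"
    and "solutions A = column_combinations A"
  obtains H where "H \<in> carrier_mat n n" "A * H + H * A = 1\<^sub>m n"
proof -
  obtain H where H: "H \<in> carrier_mat n n"
    and hyp: "\<And>j. j < n \<Longrightarrow> A *\<^sub>v col H j + H *\<^sub>v col A j = unit_vec n j"
    using partial_contraction[OF assms, of n] by auto
  have "A * H + H * A = 1\<^sub>m n"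
  proof (rule mat_col_eqI)
    fix j assume "j < dim_col (1\<^sub>m n :: 'a mat)"
    then have j: "j < n" by simp
    have "col (A * H + H * A) j = A *\<^sub>v col H j + H *\<^sub>v col A j"
      using A H j by (auto intro!: eq_vecI)
    then show "col (A * H + H * A) j = col (1\<^sub>m n) j" using hyp[OF j] j by simp
  qed (use A H in auto)
  then show ?thesis using H that by blast
qed

section \<open>The normal form\<close>

text \<open>The standard correction \<open>K = H A H\<close>. It has the same products with \<open>A\<close> as \<open>H\<close>, because
  \<open>A H A = A\<close>, and its square vanishes because the idempotents \<open>A H\<close> and \<open>H A\<close> are orthogonal.\<close>

lemma contraction_imp_square_zero_contraction:
  fixes A :: "'a::comm_ring_1 mat"
  assumes A: "A \<in> carrier_mat n n" and H: "H \<in> carrier_mat n n"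
    and AA: "A * A = 0\<^sub>m n n" and AH: "A * H + H * A = 1\<^sub>m n"
  obtains K where "K \<in> carrier_mat n n" "A * K + K * A = 1\<^sub>m n" "K * K = 0\<^sub>m n n" "A * K * A = A"
proof -
  have "A * (A * H + H * A) = A * A * H + A * H * A"
    using A H by (simp add: mult_add_distrib_mat[of _ n n _ n] mat_assoc)
  then have AHA: "A * H * A = A" using AH AA A H by simp
  define K where "K = H * A * H"
  have K: "K \<in> carrier_mat n n" unfolding K_def using A H by simp
  have AK: "A * K = A * H"
  proof -
    have "A * K = A * H * A * H" unfolding K_def using A H by (simp add: mat_assoc)
    then show ?thesis using AHA by simp
  qed
  have KA: "K * A = H * A"
  proof -
    have "K * A = H * (A * H * A)" unfolding K_def using A H by (simp add: mat_assoc)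
    then show ?thesis using AHA by simp
  qed
  have AHHA: "A * H * (H * A) = 0\<^sub>m n n"
  proof -
    have "A * H * (A * H + H * A) = A * H * (A * H) + A * H * (H * A)"
      by (rule mult_add_distrib_mat) (use A H in auto)
    also have "A * H * (A * H) = A * H * A * H" using A H by (simp add: mat_assoc)
    finally have "A * H = A * H + A * H * (H * A)" using AH AHA A H by simp
    moreover have "A * H * (H * A) = A * H + A * H * (H * A) - A * H"
      by (rule eq_matI) (use A H in auto)
    ultimately show ?thesis using A H by auto
  qed
  have "K * K = H * (A * H * (H * A)) * H" unfolding K_def using A H by (simp add: mat_assoc)
  then have KK: "K * K = 0\<^sub>m n n" using AHHA H by simp
  show ?thesis
    by (rule that[of K]) (use K AK KA KK AH AHA in simp_all)
qed

abbreviation normal_form :: "nat \<Rightarrow> 'a::comm_ring_1 mat" where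
  "normal_form r \<equiv> four_block_mat (0\<^sub>m r r) (1\<^sub>m r) (0\<^sub>m r r) (0\<^sub>m r r)"

text \<open>With \<open>A K = P Q\<close> and \<open>Q P = 1\<close>, the columns of \<open>V = [P | K P]\<close> are the adapted basis: \<open>A\<close> kills \<open>P\<close> and
  sends \<open>K P\<close> to \<open>P\<close>. The dual coordinates are the rows of \<open>U\<close>, namely \<open>Q\<close> above \<open>Q A\<close>.\<close>

lemma contraction_imp_normal_form:
  fixes A :: "'a::comm_ring_1 mat"
  assumes local: "local_ring (class_ring :: 'a ring)"
    and A: "A \<in> carrier_mat (2 * r) (2 * r)" and H: "H \<in> carrier_mat (2 * r) (2 * r)"
    and AA: "A * A = 0\<^sub>m (2 * r) (2 * r)" and AH: "A * H + H * A = 1\<^sub>m (2 * r)"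
  obtains U V where "U \<in> carrier_mat (2 * r) (2 * r)" "V \<in> carrier_mat (2 * r) (2 * r)"
    "U * V = 1\<^sub>m (2 * r)" "V * U = 1\<^sub>m (2 * r)" "U * A * V = normal_form r"
proof -
  let ?n = "2 * r"
  obtain K where K: "K \<in> carrier_mat ?n ?n" and AK: "A * K + K * A = 1\<^sub>m ?n"
    and KK: "K * K = 0\<^sub>m ?n ?n" and AKA: "A * K * A = A"
    using contraction_imp_square_zero_contraction[OF A H AA AH] by blast
  have "A * K * (A * K) = A * K * A * K" using A K by (simp add: mat_assoc)
  then have "A * K * (A * K) = A * K" using AKA by simp
  then have "splits_freely ?n (A * K)"
    using idempotent_splits_freely[OF local mult_carrier_mat[OF A K]] by blast
  then obtain s P Q
    where P: "P \<in> carrier_mat ?n s" and Q: "Q \<in> carrier_mat s ?n"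
      and PQ: "P * Q = A * K" and QP: "Q * P = 1\<^sub>m s"
    unfolding splits_freely_def by blast
  have "P * (Q * P) = P * Q * P" using P Q by (simp add: mat_assoc)
  then have eP: "A * K * P = P" using P PQ QP by simp
  have "Q * P * Q = Q * (P * Q)" using P Q by (simp add: mat_assoc)
  then have Qe: "Q * (A * K) = Q" using Q PQ QP by simp
  have "A * P = A * (A * K * P)" using eP by simp
  also have "\<dots> = A * A * (K * P)" using A K P by (simp add: mat_assoc)
  finally have AP: "A * P = 0\<^sub>m ?n s" using AA K P by simp
  have "Q * K = Q * (A * K) * K" using Qe by simp
  also have "\<dots> = Q * A * (K * K)" using A K Q by (simp add: mat_assoc)
  finally have QK: "Q * K = 0\<^sub>m s ?n" using KK A Q by simp
  have KP: "K * P \<in> carrier_mat ?n s" and QA: "Q * A \<in> carrier_mat s ?n"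
    using K P Q A by auto
  have AKP: "A * (K * P) = P" using eP A K P by (simp add: mat_assoc)
  define U where "U = Q @\<^sub>r (Q * A)"
  define V where "V = hcat P (K * P)"
  have U: "U \<in> carrier_mat (s + s) ?n" unfolding U_def by (rule carrier_append_rows[OF Q QA])
  have V: "V \<in> carrier_mat ?n (s + s)" unfolding V_def by (rule hcat_carrier[OF P KP])
  have "Q * (K * P) = Q * K * P" using Q K P by (simp add: mat_assoc)
  then have e12: "Q * (K * P) = 0\<^sub>m s s" using QK P by simp
  have "Q * A * P = Q * (A * P)" using Q A P by (simp add: mat_assoc)
  then have e21: "Q * A * P = 0\<^sub>m s s" using AP Q by simp
  have "Q * A * (K * P) = Q * (A * (K * P))" using Q A K P by (simp add: mat_assoc)
  then have e22: "Q * A * (K * P) = 1\<^sub>m s" using AKP QP by simp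
  have UV: "U * V = 1\<^sub>m (s + s)"
    unfolding U_def V_def append_rows_mult_hcat[OF Q QA P KP] QP e12 e21 e22
    by (rule four_block_one_mat)
  have "K * P * (Q * A) = K * (P * Q) * A" using K P Q A by (simp add: mat_assoc)
  also have "\<dots> = K * (A * K * A)" unfolding PQ using K A by (simp add: mat_assoc)
  finally have "K * P * (Q * A) = K * A" using AKA by simp
  then have VU: "V * U = 1\<^sub>m ?n"
    unfolding U_def V_def hcat_mult_append_rows[OF P KP Q QA] PQ using AK by simp
  have "?n = s + s"
    by (rule mat_inverses_dim_eq[OF local_ring_one_neq_zero[OF local] V U VU UV])
  then have s: "s = r" by simp
  have "A * V = hcat (0\<^sub>m ?n s) P"
    unfolding V_def mult_hcat[OF A P KP] AP AKP ..
  moreover have "U * A * V = U * (A * V)" using U A V by (simp add: mat_assoc)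
  ultimately have "U * A * V
      = four_block_mat (Q * 0\<^sub>m ?n s) (Q * P) (Q * A * 0\<^sub>m ?n s) (Q * A * P)"
    using append_rows_mult_hcat[OF Q QA zero_carrier_mat P, of s] by (simp add: U_def)
  also have "\<dots> = normal_form r"
    using Q QP e21 s right_mult_zero_mat[OF QA, of s] by simp
  finally have "U * A * V = normal_form r" .
  then show ?thesis using that[of U V] U V UV VU s by (simp add: mult_2)
qed

lemma normal_form_imp_contraction:
  fixes A :: "'a::comm_ring_1 mat"
  assumes A: "A \<in> carrier_mat (2 * r) (2 * r)"
    and U: "U \<in> carrier_mat (2 * r) (2 * r)" and V: "V \<in> carrier_mat (2 * r) (2 * r)"
    and VU: "V * U = 1\<^sub>m (2 * r)" and UV: "U * V = 1\<^sub>m (2 * r)"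
    and UAV: "U * A * V = normal_form r"
  obtains H where "H \<in> carrier_mat (2 * r) (2 * r)" "A * A = 0\<^sub>m (2 * r) (2 * r)"
    "A * H + H * A = 1\<^sub>m (2 * r)"
proof -
  let ?n = "2 * r"
  define N :: "'a mat" where "N = normal_form r"
  \<comment> \<open>The transpose of the normal form, which contracts it.\<close>
  define T :: "'a mat" where "T = four_block_mat (0\<^sub>m r r) (0\<^sub>m r r) (1\<^sub>m r) (0\<^sub>m r r)"
  have N: "N \<in> carrier_mat ?n ?n" and T: "T \<in> carrier_mat ?n ?n"
    unfolding N_def T_def mult_2 by simp_all
  have NN: "N * N = 0\<^sub>m ?n ?n"
    unfolding N_def mult_2 by (subst mult_four_block_mat[of _ r r _ r _ r]) auto
  have "N * T = four_block_mat (1\<^sub>m r) (0\<^sub>m r r) (0\<^sub>m r r) (0\<^sub>m r r)"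
    unfolding N_def T_def by (subst mult_four_block_mat[of _ r r _ r _ r]) auto
  moreover have "T * N = four_block_mat (0\<^sub>m r r) (0\<^sub>m r r) (0\<^sub>m r r) (1\<^sub>m r)"
    unfolding N_def T_def by (subst mult_four_block_mat[of _ r r _ r _ r]) auto
  ultimately have NT: "N * T + T * N = 1\<^sub>m ?n"
    by (intro eq_matI) (auto simp: mult_2)
  have "V * N * U = (V * U) * A * (V * U)"
    using A U V unfolding N_def UAV[symmetric] by (simp add: mat_assoc)
  then have A_eq: "A = V * N * U" using VU A by simp
  have conj: "(V * X * U) * (V * Y * U) = V * (X * Y) * U"
    if "X \<in> carrier_mat ?n ?n" "Y \<in> carrier_mat ?n ?n" for X Y
  proof -
    have "(V * X * U) * (V * Y * U) = V * X * (U * V) * Y * U"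
      using that U V by (simp add: mat_assoc)
    also have "\<dots> = V * X * Y * U" using UV that V by simp
    finally show ?thesis using that U V by (simp add: mat_assoc)
  qed
  have 1: "A * A = 0\<^sub>m ?n ?n" unfolding A_eq conj[OF N N] NN using U V by simp
  have "A * (V * T * U) + (V * T * U) * A = V * (N * T) * U + V * (T * N) * U"
    unfolding A_eq conj[OF N T] conj[OF T N] ..
  also have "\<dots> = V * (N * T + T * N) * U"
    using N T U V by (simp add: mult_add_distrib_mat[of _ ?n ?n _ ?n] add_mult_distrib_mat[of _ ?n ?n _ _ ?n])
  also have "\<dots> = 1\<^sub>m ?n" using NT VU V by simp
  finally show ?thesis using that[of "V * T * U"] 1 T U V by simp
qed

lemma GL_conjugate_iff:
  fixes A :: "'a::comm_ring_1 mat"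
  shows "(\<exists>U\<in>GL n. U * A * GL_inv n U = B) \<longleftrightarrow>
    (\<exists>U\<in>carrier_mat n n. \<exists>V\<in>carrier_mat n n.
       U * V = 1\<^sub>m n \<and> V * U = 1\<^sub>m n \<and> U * A * V = B)" (is "?L \<longleftrightarrow> ?R")
proof -
  interpret R: ring "ring_mat TYPE('a) n ()" by (rule ring_mat)
  have inv: "GL_inv n U = V"
    if "U \<in> carrier_mat n n" "V \<in> carrier_mat n n" "U * V = 1\<^sub>m n" "V * U = 1\<^sub>m n" for U V :: "'a mat"
    unfolding GL_inv_def by (rule R.inv_char) (use that in \<open>auto simp: ring_mat_simps\<close>)
  have GL: "U \<in> GL n \<longleftrightarrow> U \<in> carrier_mat n n \<and> (\<exists>V\<in>carrier_mat n n. U * V = 1\<^sub>m n \<and> V * U = 1\<^sub>m n)"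
    for U :: "'a mat"
    unfolding GL_def Units_def by (auto simp: ring_mat_simps)
  show ?thesis
  proof
    assume ?L
    then obtain U where "U \<in> GL n" and U: "U * A * GL_inv n U = B" by blast
    then obtain V where "U \<in> carrier_mat n n" "V \<in> carrier_mat n n" "U * V = 1\<^sub>m n" "V * U = 1\<^sub>m n"
      using GL by blast
    then show ?R using inv U by blast
  next
    assume ?R
    then show ?L using inv GL by blast
  qed
qed

theorem mainTheorem3:
  fixes A :: "'a::comm_ring_1 mat" and r :: nat
  assumes "local_ring (class_ring :: 'a ring)"
    and "r \<ge> 1"
    and "A \<in> carrier_mat (2 * r) (2 * r)"
    and "strictly_upper_triangular A"
  shows "(\<exists>U\<in>GL (2 * r).
            U * A * GL_inv (2 * r) U =
              four_block_mat (0\<^sub>m r r) (1\<^sub>m r) (0\<^sub>m r r) (0\<^sub>m r r)) \<longleftrightarrow>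
         solutions A = column_combinations A"
  unfolding GL_conjugate_iff
proof
  assume "\<exists>U\<in>carrier_mat (2 * r) (2 * r). \<exists>V\<in>carrier_mat (2 * r) (2 * r).
    U * V = 1\<^sub>m (2 * r) \<and> V * U = 1\<^sub>m (2 * r) \<and> U * A * V = normal_form r"
  then obtain H where "H \<in> carrier_mat (2 * r) (2 * r)" "A * A = 0\<^sub>m (2 * r) (2 * r)"
    "A * H + H * A = 1\<^sub>m (2 * r)"
    using normal_form_imp_contraction[OF assms(3)] by metis
  then show "solutions A = column_combinations A"
    using contraction_imp_exact[OF assms(3)] by blast
next
  assume exact: "solutions A = column_combinations A"
  obtain H where H: "H \<in> carrier_mat (2 * r) (2 * r)" "A * H + H * A = 1\<^sub>m (2 * r)"
    using exact_imp_contraction[OF assms(3,4) exact] .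
  have AA: "A * A = 0\<^sub>m (2 * r) (2 * r)" using exact_imp_square_zero[OF assms(3)] exact by simp
  show "\<exists>U\<in>carrier_mat (2 * r) (2 * r). \<exists>V\<in>carrier_mat (2 * r) (2 * r).
    U * V = 1\<^sub>m (2 * r) \<and> V * U = 1\<^sub>m (2 * r) \<and> U * A * V = normal_form r"
    using contraction_imp_normal_form[OF assms(1,3) H(1) AA H(2)] by metis
qed

end
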